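(* There exist $\alpha,\beta\in\mathbb{R}$ such that $1,\alpha,\beta$ are linearly independent over $\mathbb{Q}$, and an $\alpha\beta$-set $E\subseteq\mathbb{R}/\mathbb{Z}$, such that $\overline{\dim}_B E=1/2$.
   Context: For $\alpha,\beta\in\mathbb{R}$, an $\alpha\beta$-set is a subset $E\subseteq\mathbb{R}/\mathbb{Z}$ such that for every $x\in E$ at least one of the points $x+\alpha$, $x+\beta$ (taken mod $1$) belongs to $E$. For a set $E$, let $N(E,\rho)$ be the minimal number of intervals of length $\rho$ needed to cover $E$; the upper box dimension is $\overline{\dim}_B E=\limsup_{\rho\searrow 0}\frac{\log N(E,\rho)}{\log(1/\rho)}$. *)

theory Defs
  imports "HOL-Analysis.Analysis"
begin

quotient_type circle = real / "\<lambda>x y::real. x - y \<in> \<int>"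
  morphisms circle_rep to_circle
proof (intro equivpI reflpI sympI transpI)
  show "x - x \<in> \<int>" for x :: real
    by simp
  show "y - x \<in> \<int>" if "x - y \<in> \<int>" for x y :: real
    using Ints_minus[OF that] by simp
  show "x - z \<in> \<int>" if "x - y \<in> \<int>" "y - z \<in> \<int>" for x y z :: real
    using Ints_add[OF that] by simp
qed

lemma to_circle_eq_iff: "to_circle x = to_circle y \<longleftrightarrow> x - y \<in> \<int>"
  by (rule circle.abs_eq_iff)

instantiation circle :: ab_group_add
begin

lift_definition zero_circle :: circle is "0 :: real" .

lift_definition plus_circle :: "circle \<Rightarrow> circle \<Rightarrow> circle" is "(+) :: real \<Rightarrow> real \<Rightarrow> real"
proof -
  fix a b c d :: real
  assume "a - b \<in> \<int>" "c - d \<in> \<int>"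
  from Ints_add[OF this] show "(a + c) - (b + d) \<in> \<int>"
    by (simp add: algebra_simps)
qed

lift_definition uminus_circle :: "circle \<Rightarrow> circle" is "uminus :: real \<Rightarrow> real"
proof -
  fix a b :: real
  assume "a - b \<in> \<int>"
  from Ints_minus[OF this] show "- a - - b \<in> \<int>"
    by simp
qed

lift_definition minus_circle :: "circle \<Rightarrow> circle \<Rightarrow> circle" is "(-) :: real \<Rightarrow> real \<Rightarrow> real"
proof -
  fix a b c d :: real
  assume "a - b \<in> \<int>" "c - d \<in> \<int>"
  from Ints_diff[OF this] show "(a - c) - (b - d) \<in> \<int>"
    by (simp add: algebra_simps)
qed

instance
  by standard (transfer; simp)+

end

lemma to_circle_add: "to_circle x + to_circle y = to_circle (x + y)"
  by (rule plus_circle.abs_eq)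

definition alpha_beta_set :: "real \<Rightarrow> real \<Rightarrow> circle set \<Rightarrow> bool" where
  "alpha_beta_set \<alpha> \<beta> E \<longleftrightarrow> (\<forall>x\<in>E. x + to_circle \<alpha> \<in> E \<or> x + to_circle \<beta> \<in> E)"

text \<open>Intervals are taken closed. For \<open>\<rho> \<ge> 1\<close> an interval is the whole circle.\<close>

definition circle_intervals :: "real \<Rightarrow> circle set set" where
  "circle_intervals \<rho> = {to_circle ` {a..a + \<rho>} | a. True}"

definition covering_number :: "circle set \<Rightarrow> real \<Rightarrow> nat" where
  "covering_number E \<rho> =
     (LEAST n. \<exists>C. finite C \<and> card C = n \<and> C \<subseteq> circle_intervals \<rho> \<and> E \<subseteq> \<Union>C)"

text \<open>For \<open>\<rho> > 0\<close> the minimum is taken over a nonempty set of numbers.\<close>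

lemma finite_circle_cover:
  assumes "\<rho> > 0"
  shows "\<exists>C. finite C \<and> C \<subseteq> circle_intervals \<rho> \<and> E \<subseteq> \<Union>C"
proof -
  obtain n :: nat where n: "1 < real n * \<rho>"
    using reals_Archimedean3[OF assms] by blast
  define C where "C = (\<lambda>k. to_circle ` {real k * \<rho>..real k * \<rho> + \<rho>}) ` {..n}"
  have "y \<in> \<Union>C" for y
  proof -
    obtain z where y: "y = to_circle z"
      using circle.abs_induct[of "\<lambda>y. \<exists>z. y = to_circle z" y] by blast
    have yf: "y = to_circle (frac z)"
      unfolding y to_circle_eq_iff by (simp add: frac_def)
    define k where "k = nat \<lfloor>frac z / \<rho>\<rfloor>"
    have nn: "0 \<le> frac z / \<rho>"
      using assms by simp
    then have k: "real k \<le> frac z / \<rho>" "frac z / \<rho> < real k + 1"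
      unfolding k_def by (simp_all add: of_nat_nat)
    have "frac z / \<rho> < real n"
      using n frac_lt_1[of z] assms by (simp add: field_simps)
    with k have "k \<le> n"
      by linarith
    moreover have "frac z \<in> {real k * \<rho>..real k * \<rho> + \<rho>}"
      using k assms by (simp add: field_simps)
    ultimately show ?thesis
      unfolding C_def yf by blast
  qed
  moreover have "finite C" "C \<subseteq> circle_intervals \<rho>"
    unfolding C_def circle_intervals_def by auto
  ultimately show ?thesis
    by blast
qed

text \<open>
  For \<open>E = {}\<close> the covering number is \<open>0\<close>, so the convention \<open>ln 0 = 0\<close> gives the
  empty set dimension \<open>0\<close>.
\<close>

definition upper_box_dim :: "circle set \<Rightarrow> ereal" where
  "upper_box_dim E =
     Limsup (at_right 0) (\<lambda>\<rho>. ereal (ln (real (covering_number E \<rho>)) / ln (1 / \<rho>)))"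

text \<open>
  \<open>rat_real.independent\<close> is a property of sets: a statement about a family such as
  \<open>1, \<alpha>, \<beta>\<close> must also say that its members are pairwise distinct.
\<close>

interpretation rat_real: vector_space "\<lambda>(q::rat) (x::real). of_rat q * x"
  by standard (simp_all add: algebra_simps of_rat_add of_rat_mult)

end

theory Submission
  imports Defs "HOL-Real_Asymp.Real_Asymp"
begin

text \<open>
  A linear form \<open>p \<alpha> + q \<beta> + r\<close> with coefficients of size \<open>l\<close> is generically as small as \<open>1 / l\<^sup>2\<close>,
  and the dimension is \<open>1 / 2\<close> because this exponent can be realised at all scales by words with
  nonnegative coefficients. With \<open>m = k + 2\<close>, the words
  \<open>V' = V\<^sup>m U\<close>, \<open>W' = W\<^bsup>m+1\<^esup> U\<close>, \<open>U' = V W\<^sup>m U\<close>,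
  starting from \<open>V = \<alpha>\<close>, \<open>W = \<beta>\<close> and the empty \<open>U\<close> (regarded as a step of \<open>-1\<close>), have displacements
  \<open>s a\<close>, \<open>s b\<close>, \<open>- s c\<close> with \<open>s = (-1)\<^sup>k\<close> and \<open>a, b, c > 0\<close>, provided that
  \<open>a' = c - m a\<close>, \<open>b' = c - (m + 1) b\<close>, \<open>c' = a + m b - c\<close> remain positive.
  The inverse recursion has a positive matrix, so a compactness argument yields such \<open>\<alpha>, \<beta>\<close>.
  One step multiplies lengths by about \<open>m\<close> and displacements by about \<open>m\<^sup>-\<^sup>2\<close>. Every prefix of a later
  word stays within \<open>4 c\<close> of the points of the current words, which bounds the covering numbers from
  above. For the lower bound, the transposed recursion on integer linear forms preserves their values
  and contracts \<open>\<bar>p\<bar> + \<bar>q\<bar>\<close> by about \<open>1 / m\<close>: forms with \<open>\<bar>p\<bar> + \<bar>q\<bar> < k! / 2\<close> are at least \<open>c / 8\<close>, so the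
  first \<open>k! / 2\<close> points of any orbit are separated. The same estimate gives linear independence.
\<close>

section \<open>Covering numbers on the circle\<close>

lemma to_circle_surj: obtains z where "y = to_circle z"
  using circle.abs_induct[of "\<lambda>y. \<exists>z. y = to_circle z" y] by blast

lemma to_circle_0: "to_circle 0 = 0"
  by (simp add: zero_circle_def)

definition nbhd :: "real \<Rightarrow> circle set \<Rightarrow> circle set" where
  "nbhd R Q = {p + to_circle t | p t. p \<in> Q \<and> \<bar>t\<bar> \<le> R}"

lemma nbhdI: "p \<in> Q \<Longrightarrow> \<bar>t\<bar> \<le> R \<Longrightarrow> p + to_circle t \<in> nbhd R Q"
  unfolding nbhd_def by blast

lemma nbhd_mono: "R \<le> R' \<Longrightarrow> nbhd R Q \<subseteq> nbhd R' Q"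
proof
  fix x assume R: "R \<le> R'" and "x \<in> nbhd R Q"
  then obtain p t where pt: "p \<in> Q" "\<bar>t\<bar> \<le> R" "x = p + to_circle t"
    unfolding nbhd_def by blast
  show "x \<in> nbhd R' Q"
    unfolding pt(3) using pt(1,2) R by (intro nbhdI) auto
qed

lemma subset_nbhd_0: "Q \<subseteq> nbhd 0 Q"
proof
  fix p assume "p \<in> Q"
  then have "p + to_circle 0 \<in> nbhd 0 Q"
    by (rule nbhdI) simp
  then show "p \<in> nbhd 0 Q"
    by (simp add: to_circle_0)
qed

lemma translate_nbhd:
  assumes "A \<subseteq> nbhd R Q" "\<bar>s\<bar> + R \<le> R'"
  shows "(+) (to_circle s) ` A \<subseteq> nbhd R' Q"
proof
  fix y assume "y \<in> (+) (to_circle s) ` A"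
  then obtain p t where pt: "p \<in> Q" "\<bar>t\<bar> \<le> R" "y = to_circle s + (p + to_circle t)"
    using assms(1) unfolding nbhd_def by blast
  have "y = p + to_circle (s + t)"
    unfolding pt(3) to_circle_add[symmetric] by (simp only: ac_simps)
  moreover have "\<bar>s + t\<bar> \<le> R'"
    using pt(2) assms(2) by linarith
  ultimately show "y \<in> nbhd R' Q"
    using nbhdI[OF pt(1)] by simp
qed

text \<open>Each point of \<open>Q\<close> contributes one arc: the points within \<open>R\<close>
  of it lie in an arc of length \<open>\<rho>\<close> starting \<open>R\<close> before it. Since
  arcs are images of real intervals, \<open>rep\<close> first picks a real representative.\<close>

lemma covering_number_le:
  assumes "finite Q" "E \<subseteq> nbhd R Q" "2 * R \<le> \<rho>"
  shows "covering_number E \<rho> \<le> card Q"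
proof -
  define rep where "rep p = (SOME z. p = to_circle z)" for p
  have rep: "p = to_circle (rep p)" for p
    unfolding rep_def by (rule someI_ex) (metis to_circle_surj)
  define J where "J p = to_circle ` {rep p - R..rep p - R + \<rho>}" for p
  have "E \<subseteq> \<Union>(J ` Q)"
  proof
    fix x assume "x \<in> E"
    then obtain p t where pt: "p \<in> Q" "\<bar>t\<bar> \<le> R" "x = p + to_circle t"
      using assms(2) unfolding nbhd_def by blast
    have "x = to_circle (rep p + t)"
      using pt(3) rep[of p] to_circle_add by metis
    moreover have "rep p + t \<in> {rep p - R..rep p - R + \<rho>}"
      using pt(2) assms(3) by auto
    ultimately show "x \<in> \<Union>(J ` Q)"
      unfolding J_def using pt(1) by blast
  qed
  moreover have "J ` Q \<subseteq> circle_intervals \<rho>"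
    unfolding J_def circle_intervals_def by blast
  ultimately have "covering_number E \<rho> \<le> card (J ` Q)"
    unfolding covering_number_def using assms(1) by (intro Least_le) blast
  also have "\<dots> \<le> card Q"
    using assms(1) by (rule card_image_le)
  finally show ?thesis .
qed

text \<open>Pigeonhole: sending each point to an arc of a minimal cover that contains it is
  injective, because no arc of length \<open>\<rho>\<close> holds two of the points.\<close>

lemma le_covering_number:
  fixes x :: "nat \<Rightarrow> circle"
  assumes "\<rho> > 0" "\<And>i. i < n \<Longrightarrow> x i \<in> E"
    and sep: "\<And>i j I. i < j \<Longrightarrow> j < n \<Longrightarrow> I \<in> circle_intervals \<rho> \<Longrightarrow> \<not> (x i \<in> I \<and> x j \<in> I)"
  shows "n \<le> covering_number E \<rho>"
proof -
  obtain C0 where "finite C0" "C0 \<subseteq> circle_intervals \<rho>" "E \<subseteq> \<Union>C0"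
    using finite_circle_cover[OF assms(1), of E] by auto
  then have "\<exists>k C. finite C \<and> card C = k \<and> C \<subseteq> circle_intervals \<rho> \<and> E \<subseteq> \<Union>C"
    by (intro exI[of _ "card C0"] exI[of _ C0]) simp
  then have "\<exists>C. finite C \<and> card C = covering_number E \<rho> \<and> C \<subseteq> circle_intervals \<rho> \<and> E \<subseteq> \<Union>C"
    unfolding covering_number_def by (rule LeastI_ex)
  then obtain C where C: "finite C" "card C = covering_number E \<rho>"
      "C \<subseteq> circle_intervals \<rho>" "E \<subseteq> \<Union>C"
    by blast
  have "\<forall>i<n. \<exists>I\<in>C. x i \<in> I"
    using assms(2) C(4) by blast
  then obtain I where I: "\<And>i. i < n \<Longrightarrow> I i \<in> C \<and> x i \<in> I i"
    by metis
  have "inj_on I {..<n}"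
  proof (rule linorder_inj_onI)
    fix i j assume "i < j" "i \<in> {..<n}" "j \<in> {..<n}"
    then show "I i \<noteq> I j"
      using sep[of i j "I i"] I[of i] I[of j] C(3) by auto
  qed auto
  then have "card {..<n} \<le> card C"
    using I C(1) by (intro card_inj_on_le[where f = I]) auto
  then show ?thesis
    using C(2) by simp
qed

text \<open>Iterating a choice of successor stays in \<open>E\<close>, and \<open>d\<close>
  consecutive steps consist of some number \<open>p\<close> of steps \<open>\<alpha>\<close> and
  \<open>q = d - p\<close> steps \<open>\<beta>\<close>.\<close>

lemma alpha_beta_orbit:
  assumes "alpha_beta_set \<alpha> \<beta> E" "E \<noteq> {}"
  obtains x :: "nat \<Rightarrow> circle" where "\<And>n. x n \<in> E"
    "\<And>i d. \<exists>p q. p + q = d \<and> x (i + d) = x i + to_circle (real p * \<alpha> + real q * \<beta>)"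
proof -
  obtain x0 where x0: "x0 \<in> E"
    using assms(2) by blast
  have "\<forall>y\<in>E. \<exists>z. z \<in> E \<and> (z = y + to_circle \<alpha> \<or> z = y + to_circle \<beta>)"
    using assms(1) unfolding alpha_beta_set_def by blast
  from bchoice[OF this] obtain f
    where f: "\<And>y. y \<in> E \<Longrightarrow> f y \<in> E \<and> (f y = y + to_circle \<alpha> \<or> f y = y + to_circle \<beta>)"
    by blast
  define x where "x n = (f ^^ n) x0" for n
  have xE: "x n \<in> E" for n
    unfolding x_def using x0 f by (induction n) auto
  have "\<exists>p q. p + q = d \<and> x (i + d) = x i + to_circle (real p * \<alpha> + real q * \<beta>)" for i d
  proof (induction d)
    case 0
    then show ?case
      by (simp add: to_circle_0)
  next
    case (Suc d)
    then obtain p q where pq: "p + q = d" "x (i + d) = x i + to_circle (real p * \<alpha> + real q * \<beta>)"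
      by blast
    have "x (i + Suc d) = f (x (i + d))"
      by (simp add: x_def)
    with f[OF xE] consider "x (i + Suc d) = x (i + d) + to_circle \<alpha>"
      | "x (i + Suc d) = x (i + d) + to_circle \<beta>"
      by metis
    then show ?case
    proof cases
      case 1
      have "x (i + Suc d) = x i + to_circle (real (Suc p) * \<alpha> + real q * \<beta>)"
        unfolding 1 pq(2) by (simp add: add.assoc to_circle_add algebra_simps)
      moreover have "Suc p + q = Suc d" using pq by simp
      ultimately show ?thesis by blast
    next
      case 2
      have "x (i + Suc d) = x i + to_circle (real p * \<alpha> + real (Suc q) * \<beta>)"
        unfolding 2 pq(2) by (simp add: add.assoc to_circle_add algebra_simps)
      moreover have "p + Suc q = Suc d" using pq by simp
      ultimately show ?thesis by blast
    qed
  qed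
  with xE that show ?thesis by blast
qed

text \<open>Two of the first \<open>n\<close> orbit points in a common arc would give a linear form
  of absolute value at most \<open>\<rho>\<close> with nonnegative \<open>p\<close>,
  \<open>q\<close> and \<open>0 < p + q < n\<close>. The bound thus holds for every nonempty set of
  this kind, not only for the one built below.\<close>

lemma le_covering_number_alpha_beta:
  assumes "alpha_beta_set \<alpha> \<beta> E" "E \<noteq> {}" "0 < \<rho>"
    and lin: "\<And>p q r :: int. p \<ge> 0 \<Longrightarrow> q \<ge> 0 \<Longrightarrow> 0 < p + q \<Longrightarrow> p + q < int n \<Longrightarrow>
                \<rho> < \<bar>real_of_int p * \<alpha> + real_of_int q * \<beta> + real_of_int r\<bar>"
  shows "n \<le> covering_number E \<rho>"
proof -
  obtain x where x: "\<And>n. x n \<in> E"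
    "\<And>i d. \<exists>p q. p + q = d \<and> x (i + d) = x i + to_circle (real p * \<alpha> + real q * \<beta>)"
    using alpha_beta_orbit[OF assms(1,2)] by blast
  show ?thesis
  proof (rule le_covering_number[where x = x])
    fix i j I assume ij: "i < j" "j < n" and I: "I \<in> circle_intervals \<rho>"
    obtain p q where pq: "p + q = j - i" "x j = x i + to_circle (real p * \<alpha> + real q * \<beta>)"
      using x(2)[of "j - i" i] ij(1) by auto
    show "\<not> (x i \<in> I \<and> x j \<in> I)"
    proof
      assume "x i \<in> I \<and> x j \<in> I"
      with I obtain s y z where yz: "x i = to_circle y" "x j = to_circle z"
          "y \<in> {s..s + \<rho>}" "z \<in> {s..s + \<rho>}"
        unfolding circle_intervals_def by blast
      have "to_circle z = to_circle (y + (real p * \<alpha> + real q * \<beta>))"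
        using pq(2) yz(1,2) by (simp add: to_circle_add)
      then obtain r where "z - (y + (real p * \<alpha> + real q * \<beta>)) = of_int r"
        unfolding to_circle_eq_iff using Ints_cases by blast
      then have "\<bar>real_of_int (int p) * \<alpha> + real_of_int (int q) * \<beta> + real_of_int r\<bar> = \<bar>z - y\<bar>"
        by simp
      moreover have "\<bar>z - y\<bar> \<le> \<rho>"
        using yz(3,4) by auto
      ultimately show False
        using lin[of "int p" "int q" r] pq(1) ij by force
    qed
  qed (use x assms in auto)
qed

section \<open>Walks and their points\<close>

text \<open>A walk from \<open>0\<close> to \<open>v\<close> with steps \<open>\<alpha>, \<beta>\<close>, given by its set of points other than the
  endpoint; the empty set is a walk from \<open>0\<close> to \<open>0\<close>.\<close>

definition walk :: "real \<Rightarrow> real \<Rightarrow> circle set \<Rightarrow> circle \<Rightarrow> bool" where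
  "walk \<alpha> \<beta> P v \<longleftrightarrow> 0 \<in> insert v P \<and>
     (\<forall>x\<in>P. x + to_circle \<alpha> \<in> insert v P \<or> x + to_circle \<beta> \<in> insert v P)"

lemma walk_append:
  assumes P: "walk \<alpha> \<beta> P v" and Q: "walk \<alpha> \<beta> Q w"
  shows "walk \<alpha> \<beta> (P \<union> (+) v ` Q) (v + w)"
proof -
  have img: "insert (v + w) ((+) v ` Q) = (+) v ` insert w Q"
    by simp
  \<comment> \<open>The first walk may step onto its endpoint \<open>v\<close>, which was not among
    its own points. It is the start of the translated second walk, or the common endpoint if that
    walk has no points.\<close>
  have "v + 0 \<in> (+) v ` insert w Q"
    using Q unfolding walk_def by (intro imageI) blast
  then have "v \<in> insert (v + w) ((+) v ` Q)"
    by (simp only: img add_0_right)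
  then have sub: "insert v P \<subseteq> insert (v + w) (P \<union> (+) v ` Q)"
    by blast
  have step: "v + y + to_circle \<alpha> \<in> insert (v + w) ((+) v ` Q) \<or>
        v + y + to_circle \<beta> \<in> insert (v + w) ((+) v ` Q)" if y: "y \<in> Q" for y
  proof -
    have "y + to_circle \<alpha> \<in> insert w Q \<or> y + to_circle \<beta> \<in> insert w Q"
      using Q y unfolding walk_def by (elim conjE) (erule (1) bspec)
    then show ?thesis
      unfolding img add.assoc by (elim disjE) (rule disjI1 disjI2, erule imageI)+
  qed
  show ?thesis
    unfolding walk_def
  proof (intro conjI ballI)
    show "0 \<in> insert (v + w) (P \<union> (+) v ` Q)"
      using P sub unfolding walk_def by blast
    fix x assume "x \<in> P \<union> (+) v ` Q"
    then consider "x \<in> P" | y where "y \<in> Q" "x = v + y"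
      by blast
    then show "x + to_circle \<alpha> \<in> insert (v + w) (P \<union> (+) v ` Q) \<or>
               x + to_circle \<beta> \<in> insert (v + w) (P \<union> (+) v ` Q)"
    proof cases
      case 1
      then show ?thesis
        using P sub unfolding walk_def by blast
    next
      case 2
      then show ?thesis
        using step[of y] by blast
    qed
  qed
qed

text \<open>The points of the \<open>n\<close>-fold concatenation of a walk with displacement
  \<open>t\<close>. The displacement is a real number, not reduced mod 1, so that
  \<open>\<bar>t\<bar>\<close> can measure the drift of the copies.\<close>

definition repeat :: "nat \<Rightarrow> real \<Rightarrow> circle set \<Rightarrow> circle set" where
  "repeat n t P = (\<Union>i<n. (+) (to_circle (real i * t)) ` P)"

lemma walk_repeat:
  assumes "walk \<alpha> \<beta> P (to_circle t)"
  shows "walk \<alpha> \<beta> (repeat n t P) (to_circle (real n * t))"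
proof (induction n)
  case 0
  then show ?case
    by (simp add: repeat_def walk_def to_circle_0)
next
  case (Suc n)
  have "repeat (Suc n) t P = repeat n t P \<union> (+) (to_circle (real n * t)) ` P"
    unfolding repeat_def by (auto simp: lessThan_Suc)
  moreover have "to_circle (real (Suc n) * t) = to_circle (real n * t) + to_circle t"
    by (simp add: to_circle_add algebra_simps)
  ultimately show ?case
    using walk_append[OF Suc assms] by simp
qed

lemma card_repeat: "finite P \<Longrightarrow> finite (repeat n t P) \<and> card (repeat n t P) \<le> n * card P"
proof
  assume P: "finite P"
  then show "finite (repeat n t P)"
    unfolding repeat_def by blast
  have "card (repeat n t P) \<le> (\<Sum>i<n. card ((+) (to_circle (real i * t)) ` P))"
    unfolding repeat_def by (rule card_UN_le) simp
  also have "\<dots> \<le> (\<Sum>i<n. card P)"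
    by (intro sum_mono card_image_le P)
  finally show "card (repeat n t P) \<le> n * card P"
    by simp
qed

lemma repeat_nbhd:
  assumes "P \<subseteq> nbhd R Q" "real n * \<bar>t\<bar> + R \<le> R'"
  shows "repeat n t P \<subseteq> nbhd R' Q"
  unfolding repeat_def
proof (rule UN_least)
  fix i assume "i \<in> {..<n}"
  then have "real i * \<bar>t\<bar> \<le> real n * \<bar>t\<bar>"
    by (intro mult_right_mono) auto
  then show "(+) (to_circle (real i * t)) ` P \<subseteq> nbhd R' Q"
    using assms(2) by (intro translate_nbhd[OF assms(1)]) (simp add: abs_mult)
qed

section \<open>The expansion of a pair\<close>

text \<open>The recursion determines all three sequences from the pair \<open>a 0\<close>,
  \<open>b 0\<close>; positivity at every level is the condition that selects this pair.\<close>

locale expansion =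
  fixes a b c :: "nat \<Rightarrow> real"
  assumes a_pos: "a k > 0" and b_pos: "b k > 0" and c_pos: "c k > 0"
    and c_0: "c 0 = 1"
    and a_Suc: "a (Suc k) = c k - (real k + 2) * a k"
    and b_Suc: "b (Suc k) = c k - (real k + 3) * b k"
    and c_Suc: "c (Suc k) = a k + (real k + 2) * b k - c k"
begin

section \<open>Size of the displacements: \<open>c k\<close> is about
  \<open>1 / (k!)^2\<close>\<close>

lemma a_le: "(real k + 2) * a k \<le> c k"
  using a_Suc[of k] a_pos[of "Suc k"] by simp

lemma b_le: "(real k + 3) * b k \<le> c k"
  using b_Suc[of k] b_pos[of "Suc k"] by simp

text \<open>The last row of the inverse recursion. Its coefficients are positive, so it bounds the
  ratio of \<open>c k\<close> to \<open>c (Suc k)\<close> from both sides.\<close>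

lemma c_eq: "c k = (real k + 2) * (real k + 3) * c (Suc k) + (real k + 3) * a (Suc k)
    + (real k + 2)^2 * b (Suc k)"
  unfolding a_Suc b_Suc c_Suc by (simp add: power2_eq_square algebra_simps)

lemma c_Suc_le: "(real k + 2) * (real k + 3) * c (Suc k) \<le> c k"
  using c_eq[of k] a_pos[of "Suc k"] b_pos[of "Suc k"]
  by (simp add: add_nonneg_nonneg)

lemma c_Suc_le_6: "6 * c (Suc k) \<le> c k"
proof -
  have "6 * c (Suc k) \<le> (real k + 2) * (real k + 3) * c (Suc k)"
    using c_pos[of "Suc k"] by (intro mult_right_mono) (auto simp: algebra_simps)
  then show ?thesis
    using c_Suc_le[of k] by linarith
qed

lemma c_Suc_ge: "c k \<le> (real k + 3)^2 * c (Suc k)"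
proof -
  have 1: "(real k + 3) * a (Suc k) \<le> c (Suc k)"
    using a_le[of "Suc k"] by (simp add: algebra_simps)
  \<comment> \<open>One factor is raised to \<open>k + 4\<close> because \<open>b_le\<close> at
    level \<open>k + 1\<close> bounds \<open>(k + 4) * b (Suc k)\<close> by
    \<open>c (Suc k)\<close>.\<close>
  have "(real k + 2)^2 * b (Suc k) \<le> ((real k + 2) * (real k + 4)) * b (Suc k)"
    using b_pos[of "Suc k"] by (intro mult_right_mono) (auto simp: power2_eq_square)
  also have "\<dots> = (real k + 2) * ((real (Suc k) + 3) * b (Suc k))"
    by (simp add: algebra_simps)
  also have "\<dots> \<le> (real k + 2) * c (Suc k)"
    by (intro mult_left_mono b_le) auto
  finally have 2: "(real k + 2)^2 * b (Suc k) \<le> (real k + 2) * c (Suc k)" .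
  \<comment> \<open>The three terms of \<open>c_eq\<close> add up to the factor
    \<open>(k + 2)(k + 3) + 1 + (k + 2) = (k + 3)^2\<close>.\<close>
  show ?thesis
    using c_eq[of k] 1 2 by (simp add: power2_eq_square algebra_simps)
qed

lemma c_upper: "c k \<le> 1 / (fact k)^2"
proof (induction k)
  case 0
  then show ?case
    by (simp add: c_0)
next
  case (Suc k)
  have "(real k + 1)^2 * c (Suc k) \<le> (real k + 2) * (real k + 3) * c (Suc k)"
    using c_pos[of "Suc k"] by (intro mult_right_mono) (auto simp: power2_eq_square algebra_simps)
  also have "\<dots> \<le> 1 / (fact k)^2"
    using c_Suc_le[of k] Suc by linarith
  finally have "c (Suc k) \<le> 1 / ((real k + 1) * fact k)^2"
    by (simp add: pos_le_divide_eq power_mult_distrib mult_ac)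
  moreover have "fact (Suc k) = (real k + 1) * fact k"
    by simp
  ultimately show ?case
    by presburger
qed

lemma c_lower: "1 / (fact (k + 2))^2 \<le> c k"
proof (induction k)
  case 0
  then show ?case
    by (simp add: c_0)
next
  case (Suc k)
  then have "1 / (fact (k + 2))^2 \<le> (real k + 3)^2 * c (Suc k)"
    using c_Suc_ge[of k] by linarith
  then have "1 / ((real k + 3) * fact (k + 2))^2 \<le> c (Suc k)"
    by (simp add: pos_divide_le_eq power_mult_distrib mult_ac del: fact_Suc)
  moreover have "fact (Suc k + 2) = (real k + 3) * fact (k + 2)"
    by (simp add: algebra_simps)
  ultimately show ?case
    by presburger
qed

lemma c_decseq: "decseq c"
  using c_Suc_le_6 c_pos by (intro decseq_SucI) (smt (verit))

lemma c_tendsto: "c \<longlonglongrightarrow> 0"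
proof (rule tendsto_sandwich[OF _ _ tendsto_const])
  have "filterlim (\<lambda>k. fact k :: real) at_top sequentially"
  proof (rule filterlim_at_top_mono[OF filterlim_real_sequentially])
    show "\<forall>\<^sub>F k in sequentially. real k \<le> fact k"
      by (metis always_eventually fact_ge_self of_nat_fact of_nat_le_iff)
  qed
  then show "(\<lambda>k. 1 / (fact k)^2 :: real) \<longlonglongrightarrow> 0"
    by (intro tendsto_divide_0[OF tendsto_const] filterlim_at_top_imp_at_infinity
        filterlim_pow_at_top) auto
qed (use c_pos c_upper in \<open>auto intro!: always_eventually less_imp_le\<close>)

section \<open>Point sets of the words: endpoints, cardinalities and location\<close>

fun V W U :: "nat \<Rightarrow> circle set" where
  "V 0 = {0}"
| "W 0 = {0}"
| "U 0 = {}"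
| "V (Suc k) = repeat (k + 2) ((-1)^k * a k) (V k)
     \<union> (+) (to_circle (real (k + 2) * ((-1)^k * a k))) ` U k"
| "W (Suc k) = repeat (k + 3) ((-1)^k * b k) (W k)
     \<union> (+) (to_circle (real (k + 3) * ((-1)^k * b k))) ` U k"
| "U (Suc k) = (V k \<union> (+) (to_circle ((-1)^k * a k)) ` repeat (k + 2) ((-1)^k * b k) (W k))
     \<union> (+) (to_circle ((-1)^k * a k) + to_circle (real (k + 2) * ((-1)^k * b k))) ` U k"

lemma walks:
  "walk (a 0) (b 0) (V k) (to_circle ((-1)^k * a k)) \<and>
   walk (a 0) (b 0) (W k) (to_circle ((-1)^k * b k)) \<and>
   walk (a 0) (b 0) (U k) (to_circle (- ((-1)^k) * c k))"
proof (induction k)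
  case 0
  \<comment> \<open>The empty \<open>U 0\<close> is a walk from 0 to 0, and its nominal displacement
    \<open>- c 0 = - 1\<close> is 0 on the circle.\<close>
  have "to_circle (- 1) = 0"
    unfolding to_circle_0[symmetric] to_circle_eq_iff by simp
  then show ?case
    by (simp add: walk_def c_0)
next
  case (Suc k)
  note V = Suc[THEN conjunct1] and W = Suc[THEN conjunct2, THEN conjunct1]
    and U = Suc[THEN conjunct2, THEN conjunct2]
  have "to_circle (real (k + 2) * ((-1)^k * a k)) + to_circle (- ((-1)^k) * c k)
      = to_circle ((-1)^Suc k * a (Suc k))"
    unfolding to_circle_add a_Suc by (simp add: algebra_simps)
  with walk_append[OF walk_repeat[OF V, of "k + 2"] U]
  have 1: "walk (a 0) (b 0) (V (Suc k)) (to_circle ((-1)^Suc k * a (Suc k)))"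
    by (simp only: V.simps)
  have "to_circle (real (k + 3) * ((-1)^k * b k)) + to_circle (- ((-1)^k) * c k)
      = to_circle ((-1)^Suc k * b (Suc k))"
    unfolding to_circle_add b_Suc by (simp add: algebra_simps)
  with walk_append[OF walk_repeat[OF W, of "k + 3"] U]
  have 2: "walk (a 0) (b 0) (W (Suc k)) (to_circle ((-1)^Suc k * b (Suc k)))"
    by (simp only: W.simps)
  have "to_circle ((-1)^k * a k) + to_circle (real (k + 2) * ((-1)^k * b k))
        + to_circle (- ((-1)^k) * c k) = to_circle (- ((-1)^Suc k) * c (Suc k))"
    unfolding to_circle_add c_Suc by (simp add: algebra_simps)
  with walk_append[OF walk_append[OF V walk_repeat[OF W, of "k + 2"]] U]
  have 3: "walk (a 0) (b 0) (U (Suc k)) (to_circle (- ((-1)^Suc k) * c (Suc k)))"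
    by (simp only: U.simps)
  from 1 2 3 show ?case
    by blast
qed

text \<open>One level multiplies the largest cardinality by at most \<open>k + 4\<close>, the
  maximal number of old words in a new one. The factor 6 is \<open>3!\<close>, exact at level 0, and
  leaves room to add up the three sets.\<close>

lemma card_walks:
  "finite (V k) \<and> finite (W k) \<and> finite (U k) \<and>
   6 * card (V k) \<le> fact (k + 3) \<and> 6 * card (W k) \<le> fact (k + 3) \<and> 6 * card (U k) \<le> fact (k + 3)"
proof (induction k)
  case 0
  then show ?case
    by (simp add: numeral_eq_Suc)
next
  case (Suc k)
  let ?F = "fact (k + 3) :: nat"
  have fin: "finite (V k)" "finite (W k)" "finite (U k)"
    and le: "6 * card (V k) \<le> ?F" "6 * card (W k) \<le> ?F" "6 * card (U k) \<le> ?F"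
    using Suc by auto
  have img: "card ((+) x ` U k) \<le> card (U k)" for x :: circle
    by (rule card_image_le[OF fin(3)])
  have rep: "card (repeat n t (V k)) \<le> n * card (V k)" "card (repeat n t (W k)) \<le> n * card (W k)"
    and finrep: "finite (repeat n t (V k))" "finite (repeat n t (W k))" for n t
    using card_repeat fin by blast+
  have "card (V (Suc k)) \<le> (k + 2) * card (V k) + card (U k)"
    unfolding V.simps by (intro order_trans[OF card_Un_le] add_mono rep img)
  moreover have "card (W (Suc k)) \<le> (k + 3) * card (W k) + card (U k)"
    unfolding W.simps by (intro order_trans[OF card_Un_le] add_mono rep img)
  moreover have "card ((+) x ` repeat (k + 2) t (W k)) \<le> (k + 2) * card (W k)" for x :: circle and t
    using card_image_le[OF finrep(2)] rep(2) order_trans by blast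
  then have "card (U (Suc k)) \<le> (card (V k) + (k + 2) * card (W k)) + card (U k)"
    unfolding U.simps
    by (intro order_trans[OF card_Un_le] add_mono img order_refl)
  moreover have "(k + 2) * (6 * card (V k)) \<le> (k + 2) * ?F" "(k + 3) * (6 * card (W k)) \<le> (k + 3) * ?F"
      "(k + 2) * (6 * card (W k)) \<le> (k + 2) * ?F"
    using le by (intro mult_left_mono; simp)+
  moreover have "fact (Suc k + 3) = (k + 4) * ?F"
    by (simp add: numeral_eq_Suc)
  ultimately have "6 * card (V (Suc k)) \<le> fact (Suc k + 3)" "6 * card (W (Suc k)) \<le> fact (Suc k + 3)"
      "6 * card (U (Suc k)) \<le> fact (Suc k + 3)"
    using le by (simp_all only: add_mult_distrib add_mult_distrib2 mult.left_commute[of 6])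
  moreover have "finite (V (Suc k))" "finite (W (Suc k))" "finite (U (Suc k))"
    using fin finrep by simp_all
  ultimately show ?case
    by blast
qed

text \<open>Building level \<open>j + 1\<close> translates level-\<open>j\<close> words by at most
  \<open>2 * c j\<close>, and these shifts are summable. Writing the radius as a difference makes
  the sum telescope.\<close>

lemma walks_nbhd:
  "V (k + n) \<union> W (k + n) \<union> U (k + n) \<subseteq> nbhd (4 * c k - 4 * c (k + n)) (V k \<union> W k \<union> U k)"
proof (induction n)
  case 0
  then show ?case
    using subset_nbhd_0 by simp
next
  case (Suc n)
  define j where "j = k + n"
  let ?Q = "V k \<union> W k \<union> U k" and ?R = "4 * c k - 4 * c j" and ?R' = "4 * c k - 4 * c (Suc j)"
  have IH: "V j \<subseteq> nbhd ?R ?Q" "W j \<subseteq> nbhd ?R ?Q" "U j \<subseteq> nbhd ?R ?Q"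
    using Suc unfolding j_def by auto
  \<comment> \<open>Since \<open>c (Suc j)\<close> is at most a sixth of \<open>c j\<close>, the
    increase \<open>4 * c j - 4 * c (Suc j)\<close> exceeds \<open>2 * c j\<close>.\<close>
  have R: "?R + 2 * c j \<le> ?R'"
    using c_Suc_le_6[of j] c_pos[of "Suc j"] by linarith
  have cj: "0 < c j" "0 < a j" "0 < b j"
    using c_pos a_pos b_pos by auto
  have abs: "\<bar>(-1)^j * a j\<bar> = a j" "\<bar>(-1)^j * b j\<bar> = b j"
    using cj by (simp_all add: abs_mult)
  have a1: "(2 + real j) * a j \<le> c j" and b1: "(real j + 3) * b j \<le> c j"
    using a_le[of j] b_le[of j] by (simp_all add: add.commute)
  have b2: "(2 + real j) * b j \<le> c j"
    using b1 cj(3) by (simp add: algebra_simps)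
  have a2: "a j \<le> c j"
  proof -
    have "1 * a j \<le> (2 + real j) * a j"
      using cj by (intro mult_right_mono) auto
    then show ?thesis
      using a1 by simp
  qed
  have "V (Suc j) \<subseteq> nbhd ?R' ?Q"
    unfolding V.simps
    by (intro Un_least repeat_nbhd[OF IH(1)] translate_nbhd[OF IH(3)])
       (use R a1 cj abs in \<open>simp_all add: abs_mult\<close>)
  moreover have "W (Suc j) \<subseteq> nbhd ?R' ?Q"
    unfolding W.simps
    by (intro Un_least repeat_nbhd[OF IH(2)] translate_nbhd[OF IH(3)])
       (use R b1 cj abs in \<open>simp_all add: abs_mult\<close>)
  moreover have "U (Suc j) \<subseteq> nbhd ?R' ?Q"
    unfolding U.simps
  proof (intro Un_least)
    show "V j \<subseteq> nbhd ?R' ?Q"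
      using IH(1) nbhd_mono[of ?R ?R' ?Q] R cj by force
    have "repeat (j + 2) ((-1)^j * b j) (W j) \<subseteq> nbhd (?R + c j) ?Q"
      by (intro repeat_nbhd[OF IH(2)]) (use b2 abs in simp)
    then show "(+) (to_circle ((-1)^j * a j)) ` repeat (j + 2) ((-1)^j * b j) (W j) \<subseteq> nbhd ?R' ?Q"
      by (rule translate_nbhd) (use R a2 abs in linarith)
    have "\<bar>(-1)^j * a j + real (j + 2) * ((-1)^j * b j)\<bar> \<le> a j + (2 + real j) * b j"
      using abs_triangle_ineq[of "(-1)^j * a j" "real (j + 2) * ((-1)^j * b j)"] abs
      by (simp add: abs_mult)
    then show "(+) (to_circle ((-1)^j * a j) + to_circle (real (j + 2) * ((-1)^j * b j))) ` U j
        \<subseteq> nbhd ?R' ?Q"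
      unfolding to_circle_add by (intro translate_nbhd[OF IH(3)]) (use R a2 b2 in linarith)
  qed
  ultimately show ?case
    unfolding j_def by (simp only: add_Suc_right Un_least)
qed

section \<open>The limit set and the upper bound for its covering numbers\<close>

definition orbit :: "circle set" where
  "orbit = (\<Union>k. V k)"

text \<open>The word \<open>V (Suc k)\<close> starts with \<open>k + 2 \<ge> 2\<close> copies of
  \<open>V k\<close>: copy 0 is \<open>V k\<close> itself, and copy 1 starts at its endpoint. So no
  walk gets stuck in the union.\<close>

lemma V_Suc: "insert (to_circle ((-1)^k * a k)) (V k) \<subseteq> V (Suc k)"
proof -
  have sub: "(+) (to_circle (real i * ((-1)^k * a k))) ` V k \<subseteq> V (Suc k)" if "i < k + 2" for i k
    unfolding V.simps repeat_def by (rule subset_trans[OF UN_upper Un_upper1]) (use that in simp)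
  have le: "V k \<subseteq> V (Suc k)" for k
    using sub[of 0 k] by (simp add: to_circle_0 del: V.simps)
  have "0 \<in> V k"
  proof (induction k)
    case (Suc k)
    then show ?case
      using le by blast
  qed simp
  then have "to_circle ((-1)^k * a k) + 0 \<in> (+) (to_circle ((-1)^k * a k)) ` V k"
    by (rule imageI)
  then have "to_circle ((-1)^k * a k) \<in> V (Suc k)"
    using sub[of 1 k] by (simp only: add_0_right of_nat_1 mult_1_left) (auto simp del: V.simps)
  with le show ?thesis
    by blast
qed

lemma V_mono: "j \<le> k \<Longrightarrow> V j \<subseteq> V k"
  using lift_Suc_mono_le[of V] V_Suc by blast

lemma orbit_nonempty: "orbit \<noteq> {}"
  unfolding orbit_def using V.simps(1) by blast

lemma alpha_beta_set_orbit: "alpha_beta_set (a 0) (b 0) orbit"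
  unfolding alpha_beta_set_def
proof
  fix x assume "x \<in> orbit"
  then obtain k where "x \<in> V k"
    unfolding orbit_def by blast
  then have "x + to_circle (a 0) \<in> V (Suc k) \<or> x + to_circle (b 0) \<in> V (Suc k)"
    using walks[of k] V_Suc[of k] unfolding walk_def by blast
  then show "x + to_circle (a 0) \<in> orbit \<or> x + to_circle (b 0) \<in> orbit"
    unfolding orbit_def by blast
qed

text \<open>Every \<open>V j\<close> lies in some \<open>V (k + j)\<close>, and the radius of
  \<open>walks_nbhd\<close> stays below \<open>4 * c k\<close> for all \<open>j\<close>. Hence arcs
  of length \<open>8 * c k\<close> around the level-\<open>k\<close> points suffice.\<close>

lemma covering_number_orbit_le:
  assumes "8 * c k \<le> \<rho>"
  shows "covering_number orbit \<rho> \<le> fact (k + 3)"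
proof -
  have "orbit \<subseteq> nbhd (4 * c k) (V k \<union> W k \<union> U k)"
    unfolding orbit_def
  proof (rule UN_least)
    fix j
    have "V j \<subseteq> V (k + j)"
      by (rule V_mono) simp
    also have "\<dots> \<subseteq> nbhd (4 * c k - 4 * c (k + j)) (V k \<union> W k \<union> U k)"
      using walks_nbhd[of k j] by blast
    also have "\<dots> \<subseteq> nbhd (4 * c k) (V k \<union> W k \<union> U k)"
      using c_pos[of "k + j"] by (intro nbhd_mono) simp
    finally show "V j \<subseteq> nbhd (4 * c k) (V k \<union> W k \<union> U k)" .
  qed
  then have "covering_number orbit \<rho> \<le> card (V k \<union> W k \<union> U k)"
    using card_walks[of k] assms by (intro covering_number_le) auto
  also have "\<dots> \<le> card (V k) + card (W k) + card (U k)"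
    by (intro order_trans[OF card_Un_le] add_right_mono card_Un_le)
  also have "\<dots> \<le> fact (k + 3)"
    using card_walks[of k] by linarith
  finally show ?thesis .
qed

section \<open>Integer linear forms\<close>

text \<open>The new coefficients come from substituting the inverse recursion into the form, so its
  value is kept. They look larger, but when \<open>L\<close> is small \<open>r\<close> nearly
  cancels \<open>p\<close> and \<open>q\<close>; this gives contraction up to an error proportional
  to \<open>\<bar>L\<bar>\<close>.\<close>

lemma form_descent:
  fixes p q r :: int
  assumes L: "p * a k + q * b k + r * c k = L"
  defines "p' \<equiv> p + q + (int k + 3) * r"
    and "q' \<equiv> (int k + 2) * p + (int k + 1) * q + (int k + 2)^2 * r"
    and "r' \<equiv> (int k + 3) * p + (int k + 2) * q + (int k + 2) * (int k + 3) * r"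
  shows "p' * a (Suc k) + q' * b (Suc k) + r' * c (Suc k) = L"
    and "real_of_int (\<bar>p'\<bar> + \<bar>q'\<bar>) \<le> real_of_int (\<bar>p\<bar> + \<bar>q\<bar>) / (real k + 1) + 2 * \<bar>L\<bar> / c (Suc k)"
    and "p' = 0 \<Longrightarrow> q' = 0 \<Longrightarrow> r' = 0 \<Longrightarrow> p = 0 \<and> q = 0 \<and> r = 0"
proof -
  define m where "m = real k + 2"
  have m: "m \<ge> 2"
    by (simp add: m_def)
  have p': "real_of_int p' = p + q + (m + 1) * r"
    and q': "real_of_int q' = m * p + (m - 1) * q + m^2 * r"
    and r': "real_of_int r' = (m + 1) * p + m * q + m * (m + 1) * r"
    unfolding p'_def q'_def r'_def m_def by (simp_all add: algebra_simps power2_eq_square)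
  have a': "a (Suc k) = c k - m * a k" and b': "b (Suc k) = c k - (m + 1) * b k"
    and c': "c (Suc k) = a k + m * b k - c k"
    unfolding a_Suc b_Suc c_Suc m_def by simp_all
  show "p' * a (Suc k) + q' * b (Suc k) + r' * c (Suc k) = L"
    unfolding p' q' r' a' b' c' L[symmetric] by (simp add: algebra_simps power2_eq_square)
  show "p = 0 \<and> q = 0 \<and> r = 0" if z: "p' = 0" "q' = 0" "r' = 0"
  proof -
    \<comment> \<open>The integer substitution is inverted by hand, so a nonzero form stays
      nonzero.\<close>
    have "p = r' - (int k + 2) * p'"
      unfolding p'_def r'_def by (simp add: algebra_simps)
    then have p: "p = 0" using z by simp
    have "p + r = q' - (int k + 1) * p'"
      unfolding p'_def q'_def by (simp add: algebra_simps power2_eq_square)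
    then have r: "r = 0" using z p by simp
    show ?thesis
      using p r z(1) unfolding p'_def by simp
  qed
  \<comment> \<open>The common unit of length: all level \<open>k + 1\<close> quantities are at most
    \<open>x\<close>, while \<open>a k\<close> is at most \<open>(m + 1) * x\<close> and
    \<open>b k\<close> at most \<open>m * x\<close>.\<close>
  define x where "x = c k / (m * (m + 1))"
  have c: "c k = m * (m + 1) * x"
    unfolding x_def using m by simp
  have x: "x > 0"
    unfolding x_def using m c_pos[of k] by simp
  have "m * (m + 1) * c (Suc k) \<le> m * (m + 1) * x"
    unfolding c[symmetric] using c_Suc_le[of k] by (simp add: m_def algebra_simps)
  then have c'x: "c (Suc k) \<le> x"
    using m by simp
  have pos: "0 < a k" "0 < b k" "0 < a (Suc k)" "0 < b (Suc k)" "0 < c (Suc k)"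
    using a_pos b_pos c_pos by auto
  have "m * a (Suc k) \<le> (real (Suc k) + 2) * a (Suc k)"
    "m * b (Suc k) \<le> (real (Suc k) + 3) * b (Suc k)"
    using pos by (auto intro!: mult_right_mono simp: m_def)
  then have ma': "m * a (Suc k) \<le> x" and mb': "m * b (Suc k) \<le> x"
    using a_le[of "Suc k"] b_le[of "Suc k"] c'x by linarith+
  have "1 * a (Suc k) \<le> m * a (Suc k)" "1 * b (Suc k) \<le> m * b (Suc k)"
    using pos m by (auto intro!: mult_right_mono)
  with ma' mb' have a'x: "a (Suc k) \<le> x" and b'x: "b (Suc k) \<le> x"
    by linarith+
  have "m * a k \<le> m * ((m + 1) * x)" "(m + 1) * b k \<le> (m + 1) * (m * x)"
    using a_le[of k] b_le[of k] unfolding c m_def by (simp_all add: algebra_simps)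
  then have ax: "a k \<le> (m + 1) * x" and bx: "b k \<le> m * x"
    using m by simp_all
  have mx: "2 * x \<le> m * x"
    using m x by simp
  have A: "\<bar>a (Suc k) - a k\<bar> \<le> (m + 1) * x"
    using ax a'x pos mx x unfolding distrib_right by linarith
  have B: "\<bar>(m - 1) * b (Suc k) - b k\<bar> \<le> m * x"
  proof -
    have "0 \<le> (m - 1) * b (Suc k)" "(m - 1) * b (Suc k) \<le> x"
      using mb' pos m by (simp_all add: algebra_simps)
    then show ?thesis
      using bx pos mx x by linarith
  qed
  \<comment> \<open>After multiplication by \<open>c k\<close>, the product \<open>r * c k\<close>
    is replaced by \<open>L - p * a k - q * b k\<close>. This removes \<open>r\<close>, on which no
    bound is available.\<close>
  have "p' * c k = p * (a (Suc k) - a k) + q * b (Suc k) + (m + 1) * L"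
    unfolding p' a' b' L[symmetric] by (simp add: algebra_simps)
  then have "\<bar>p' * c k\<bar> \<le> \<bar>p * (a (Suc k) - a k)\<bar> + \<bar>q * b (Suc k)\<bar> + \<bar>(m + 1) * L\<bar>"
    by linarith
  also have "\<dots> \<le> \<bar>p\<bar> * ((m + 1) * x) + \<bar>q\<bar> * x + (m + 1) * \<bar>L\<bar>"
    using A b'x pos m by (intro add_mono) (auto simp: abs_mult intro!: mult_left_mono)
  finally have P: "\<bar>p'\<bar> * c k \<le> \<bar>p\<bar> * ((m + 1) * x) + \<bar>q\<bar> * x + (m + 1) * \<bar>L\<bar>"
    using c_pos[of k] by (simp add: abs_mult)
  have "q' * c k = p * (m * a (Suc k)) + q * ((m - 1) * b (Suc k) - b k) + m^2 * L"
    unfolding q' a' b' L[symmetric] by (simp add: algebra_simps power2_eq_square)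
  then have "\<bar>q' * c k\<bar> \<le> \<bar>p * (m * a (Suc k))\<bar> + \<bar>q * ((m - 1) * b (Suc k) - b k)\<bar> + \<bar>m^2 * L\<bar>"
    by linarith
  also have "\<dots> \<le> \<bar>p\<bar> * x + \<bar>q\<bar> * (m * x) + m^2 * \<bar>L\<bar>"
    using B ma' pos m by (intro add_mono) (auto simp: abs_mult intro!: mult_left_mono)
  finally have Q: "\<bar>q'\<bar> * c k \<le> \<bar>p\<bar> * x + \<bar>q\<bar> * (m * x) + m^2 * \<bar>L\<bar>"
    using c_pos[of k] by (simp add: abs_mult)
  have split: "(S * (A * x) + B * l) / (D * x) = S * (A / D) + B / D * (l / x)"
    if "x \<noteq> 0" "D \<noteq> 0" for S A B D l x :: real
    using that by (simp add: add_divide_distrib)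
  \<comment> \<open>The two bounds together give \<open>\<bar>p\<bar>\<close> the weight
    \<open>(m + 2) * x\<close> and \<open>\<bar>q\<bar>\<close> only \<open>(m + 1) * x\<close>; the
    difference is then dropped.\<close>
  have "real_of_int (\<bar>p'\<bar> + \<bar>q'\<bar>) * c k \<le> real_of_int (\<bar>p\<bar> + \<bar>q\<bar>) * ((m + 2) * x) - \<bar>q\<bar> * x + (m^2 + m + 1) * \<bar>L\<bar>"
    using P Q by (simp add: algebra_simps)
  then have "real_of_int (\<bar>p'\<bar> + \<bar>q'\<bar>) * c k \<le> real_of_int (\<bar>p\<bar> + \<bar>q\<bar>) * ((m + 2) * x) + (m^2 + m + 1) * \<bar>L\<bar>"
    using x by (smt (verit) mult_nonneg_nonneg of_int_0_le_iff abs_ge_zero)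
  then have "real_of_int (\<bar>p'\<bar> + \<bar>q'\<bar>)
      \<le> (real_of_int (\<bar>p\<bar> + \<bar>q\<bar>) * ((m + 2) * x) + (m^2 + m + 1) * \<bar>L\<bar>) / c k"
    using c_pos[of k] by (simp add: pos_le_divide_eq)
  also have "\<dots> = real_of_int (\<bar>p\<bar> + \<bar>q\<bar>) * ((m + 2) / (m * (m + 1))) + (m^2 + m + 1) / (m * (m + 1)) * (\<bar>L\<bar> / x)"
    unfolding c by (rule split) (use x m in auto)
  also have "\<dots> \<le> real_of_int (\<bar>p\<bar> + \<bar>q\<bar>) * (1 / (real k + 1)) + 2 * (\<bar>L\<bar> / c (Suc k))"
  proof (intro add_mono mult_mono mult_left_mono)
    have "(m + 2) * (m - 1) \<le> m * (m + 1)"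
      using m by (simp add: algebra_simps)
    then have "(m + 2) / (m * (m + 1)) \<le> 1 / (m - 1)"
      using m by (simp add: divide_simps)
    moreover have "m - 1 = real k + 1"
      by (simp add: m_def)
    ultimately show "(m + 2) / (m * (m + 1)) \<le> 1 / (real k + 1)"
      by simp
    have "1 \<le> m * m"
      using m mult_mono[of 1 m 1 m] by simp
    then have "m^2 + m + 1 \<le> 2 * (m * (m + 1))"
      using m by (simp add: algebra_simps power2_eq_square)
    then show "(m^2 + m + 1) / (m * (m + 1)) \<le> 2"
      using m by (simp add: pos_divide_le_eq)
    show "\<bar>L\<bar> / x \<le> \<bar>L\<bar> / c (Suc k)"
      using c'x pos by (intro divide_left_mono) auto
  qed (use x m in auto)
  finally show "real_of_int (\<bar>p'\<bar> + \<bar>q'\<bar>) \<le> real_of_int (\<bar>p\<bar> + \<bar>q\<bar>) / (real k + 1) + 2 * \<bar>L\<bar> / c (Suc k)"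
    by simp
qed

text \<open>The contraction factors \<open>1 / (k + 1)\<close> multiply to \<open>1 / k!\<close>.
  The constant 4 reproduces itself: by the factor 6 between successive \<open>c\<close>, the old
  error is at most \<open>2 * \<bar>L\<bar> / c (Suc k)\<close>, and the step adds as much
  again.\<close>

lemma form_descent_iterate:
  fixes p q r :: int
  assumes L: "p * a 0 + q * b 0 + r * c 0 = L"
  shows "\<exists>p' q' r' :: int. p' * a k + q' * b k + r' * c k = L
    \<and> real_of_int (\<bar>p'\<bar> + \<bar>q'\<bar>) \<le> real_of_int (\<bar>p\<bar> + \<bar>q\<bar>) / fact k + 4 * \<bar>L\<bar> / c k
    \<and> (p' = 0 \<and> q' = 0 \<and> r' = 0 \<longrightarrow> p = 0 \<and> q = 0 \<and> r = 0)"
proof (induction k)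
  case 0
  have "real_of_int (\<bar>p\<bar> + \<bar>q\<bar>) \<le> real_of_int (\<bar>p\<bar> + \<bar>q\<bar>) / fact 0 + 4 * \<bar>L\<bar> / c 0"
    using c_pos[of 0] by simp
  then show ?case
    using L by blast
next
  case (Suc k)
  then obtain p1 q1 r1 :: int where form: "p1 * a k + q1 * b k + r1 * c k = L"
    and bound: "real_of_int (\<bar>p1\<bar> + \<bar>q1\<bar>) \<le> real_of_int (\<bar>p\<bar> + \<bar>q\<bar>) / fact k + 4 * \<bar>L\<bar> / c k"
    and zero: "p1 = 0 \<and> q1 = 0 \<and> r1 = 0 \<longrightarrow> p = 0 \<and> q = 0 \<and> r = 0"
    by blast
  note descent = form_descent[OF form]
  have "real_of_int (\<bar>p1\<bar> + \<bar>q1\<bar>) / (real k + 1)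
      \<le> (real_of_int (\<bar>p\<bar> + \<bar>q\<bar>) / fact k + 4 * \<bar>L\<bar> / c k) / (real k + 1)"
    by (intro divide_right_mono bound) auto
  also have "\<dots> = real_of_int (\<bar>p\<bar> + \<bar>q\<bar>) / fact (Suc k) + 4 * \<bar>L\<bar> / c k / (real k + 1)"
    by (simp add: add_divide_distrib algebra_simps)
  also have "4 * \<bar>L\<bar> / c k / (real k + 1) \<le> 4 * \<bar>L\<bar> / c k"
    using c_pos[of k] by (simp add: divide_le_eq mult_le_cancel_left1)
  also have "4 * \<bar>L\<bar> / c k \<le> 4 * \<bar>L\<bar> / (6 * c (Suc k))"
    using c_Suc_le_6[of k] c_pos by (intro divide_left_mono) auto
  also have "\<dots> \<le> 2 * \<bar>L\<bar> / c (Suc k)"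
    using c_pos[of "Suc k"] by (simp add: field_simps)
  finally have "real_of_int (\<bar>p1\<bar> + \<bar>q1\<bar>) / (real k + 1) + 2 * \<bar>L\<bar> / c (Suc k)
      \<le> real_of_int (\<bar>p\<bar> + \<bar>q\<bar>) / fact (Suc k) + 4 * \<bar>L\<bar> / c (Suc k)"
    by linarith
  then show ?case
    using descent zero order_trans by (intro exI conjI) blast+
qed

text \<open>If the value were below \<open>c k / 8\<close>, both terms of the descended bound would
  be below 1/2, so the integers \<open>p'\<close>, \<open>q'\<close> vanish. Then
  \<open>\<bar>r'\<bar> * c k = \<bar>L\<bar> < c k\<close> forces \<open>r' = 0\<close>, against
  injectivity.\<close>

lemma form_ge:
  fixes p q r :: int
  assumes small: "2 * (\<bar>p\<bar> + \<bar>q\<bar>) < fact k" and nz: "p \<noteq> 0 \<or> q \<noteq> 0 \<or> r \<noteq> 0"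
  shows "c k / 8 \<le> \<bar>p * a 0 + q * b 0 + r\<bar>"
proof (rule ccontr)
  define L where "L = p * a 0 + q * b 0 + r * c 0"
  assume "\<not> ?thesis"
  then have "\<bar>L\<bar> < c k / 8"
    unfolding L_def c_0 by simp
  then have Lc: "4 * \<bar>L\<bar> / c k < 1 / 2"
    using c_pos[of k] by (simp add: field_simps)
  obtain p' q' r' :: int where form: "p' * a k + q' * b k + r' * c k = L"
    and bound: "real_of_int (\<bar>p'\<bar> + \<bar>q'\<bar>) \<le> real_of_int (\<bar>p\<bar> + \<bar>q\<bar>) / fact k + 4 * \<bar>L\<bar> / c k"
    and zero: "p' = 0 \<and> q' = 0 \<and> r' = 0 \<longrightarrow> p = 0 \<and> q = 0 \<and> r = 0"
    using form_descent_iterate[OF L_def[symmetric]] by blast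
  have "real_of_int (2 * (\<bar>p\<bar> + \<bar>q\<bar>)) < real_of_int (fact k)"
    using small by (simp only: of_int_less_iff)
  then have "real_of_int (\<bar>p\<bar> + \<bar>q\<bar>) / fact k < 1 / 2"
    by (simp add: divide_less_eq)
  then have "real_of_int (\<bar>p'\<bar> + \<bar>q'\<bar>) < 1"
    using bound Lc by linarith
  then have pq: "p' = 0" "q' = 0"
    by linarith+
  then have "\<bar>real_of_int r'\<bar> * c k = \<bar>L\<bar>"
    using form c_pos[of k] by (auto simp: abs_mult)
  also have "\<dots> < 1 * c k"
    using \<open>\<bar>L\<bar> < c k / 8\<close> c_pos[of k] by linarith
  finally have "r' = 0"
    using c_pos[of k] by (simp only: mult_less_cancel_right_pos)
  then show False
    using pq zero nz by blast
qed

end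

section \<open>Existence of an expansion\<close>

definition step :: "nat \<Rightarrow> real \<times> real \<times> real \<Rightarrow> real \<times> real \<times> real" where
  "step k v = (snd (snd v) - (real k + 2) * fst v, snd (snd v) - (real k + 3) * fst (snd v),
     fst v + (real k + 2) * fst (snd v) - snd (snd v))"

definition unstep :: "nat \<Rightarrow> real \<times> real \<times> real \<Rightarrow> real \<times> real \<times> real" where
  "unstep k v =
     (fst v + (real k + 2) * fst (snd v) + (real k + 3) * snd (snd v),
      fst v + (real k + 1) * fst (snd v) + (real k + 2) * snd (snd v),
      (real k + 3) * fst v + (real k + 2)^2 * fst (snd v) + (real k + 2) * (real k + 3) * snd (snd v))"

lemma step_unstep: "step k (unstep k v) = v"
  unfolding step_def unstep_def by (simp add: algebra_simps power2_eq_square prod_eq_iff)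

lemma unstep_step: "unstep k (step k v) = v"
  unfolding step_def unstep_def by (simp add: algebra_simps power2_eq_square prod_eq_iff)

lemma step_scaleR: "step k (s *\<^sub>R v) = s *\<^sub>R step k v"
  unfolding step_def by (simp add: algebra_simps)

primrec steps :: "real \<times> real \<times> real \<Rightarrow> nat \<Rightarrow> real \<times> real \<times> real" where
  "steps v 0 = v"
| "steps v (Suc k) = step k (steps v k)"

text \<open>Starts with \<open>(1, 1, 1)\<close> at level \<open>n + k\<close> and runs the
  recursion backwards to level \<open>k\<close>. This yields triples that are positive for a
  prescribed number of levels.\<close>

primrec unsteps :: "nat \<Rightarrow> nat \<Rightarrow> real \<times> real \<times> real" where
  "unsteps 0 k = (1, 1, 1)"
| "unsteps (Suc n) k = unstep k (unsteps n (Suc k))"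

lemma steps_scaleR: "steps (s *\<^sub>R v) k = s *\<^sub>R steps v k"
  by (induction k) (auto simp: step_scaleR)

lemma steps_unsteps: "steps (unsteps (n + k) 0) k = unsteps n k"
proof (induction k arbitrary: n)
  case (Suc k)
  from Suc[of "Suc n"] show ?case
    by (simp add: step_unstep)
qed simp

definition nonneg3 :: "real \<times> real \<times> real \<Rightarrow> bool" where
  "nonneg3 v \<longleftrightarrow> 0 \<le> fst v \<and> 0 \<le> fst (snd v) \<and> 0 \<le> snd (snd v)"

definition pos3 :: "real \<times> real \<times> real \<Rightarrow> bool" where
  "pos3 v \<longleftrightarrow> 0 < fst v \<and> 0 < fst (snd v) \<and> 0 < snd (snd v)"

text \<open>All matrix entries are positive. This keeps the approximating triples positive and later
  upgrades nonnegativity of the limit to strict positivity.\<close>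

lemma pos3_unstep:
  assumes "nonneg3 v" "v \<noteq> 0"
  shows "pos3 (unstep k v)"
proof -
  have *: "0 < x * fst v + y * fst (snd v) + z * snd (snd v)" if "x > 0" "y > 0" "z > 0" for x y z
  proof -
    have "0 \<le> x * fst v" "0 \<le> y * fst (snd v)" "0 \<le> z * snd (snd v)"
      using assms(1) that unfolding nonneg3_def by auto
    moreover have "x * fst v \<noteq> 0 \<or> y * fst (snd v) \<noteq> 0 \<or> z * snd (snd v) \<noteq> 0"
      using assms(2) that by (auto simp: prod_eq_iff)
    ultimately show ?thesis
      by linarith
  qed
  show ?thesis
    unfolding pos3_def unstep_def
    using *[of 1 "real k + 2" "real k + 3"] *[of 1 "real k + 1" "real k + 2"]
      *[of "real k + 3" "(real k + 2)^2" "(real k + 2) * (real k + 3)"]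
    by simp
qed

lemma pos3_unsteps: "pos3 (unsteps n k)"
proof (induction n arbitrary: k)
  case 0
  then show ?case
    by (simp add: pos3_def)
next
  case (Suc n)
  have "nonneg3 (unsteps n (Suc k))" "unsteps n (Suc k) \<noteq> 0"
    using Suc[of "Suc k"] by (auto simp: pos3_def nonneg3_def)
  then show ?case
    by (simp add: pos3_unstep)
qed

lemma expansion_exists: "\<exists>a b c. expansion a b c"
proof -
  \<comment> \<open>Scaling commutes with the recursion, so the last coordinate may be set to 1, the
    required value of \<open>c 0\<close>.\<close>
  define v where "v n = (1 / snd (snd (unsteps n 0))) *\<^sub>R unsteps n 0" for n
  have v: "v n \<in> {0..1} \<times> ({0..1} \<times> {1})" for n
  proof -
    obtain x y z where xyz: "unsteps n 0 = (x, y, z)"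
      using prod_cases3 by blast
    have pos: "0 < x" "0 < y" "0 < z"
      using pos3_unsteps[of n 0] unfolding xyz pos3_def by auto
    \<comment> \<open>Positivity one level up gives \<open>2 * x < z\<close> and
      \<open>3 * y < z\<close>; only the starting triple \<open>(1, 1, 1)\<close> is separate. So
      all \<open>v n\<close> lie in a compact box.\<close>
    have "x \<le> z \<and> y \<le> z"
    proof (cases n)
      case 0
      then show ?thesis
        using xyz by simp
    next
      case (Suc n')
      have "step 0 (x, y, z) = unsteps n' (Suc 0)"
        unfolding xyz[symmetric] Suc by (simp add: step_unstep)
      then have "pos3 (step 0 (x, y, z))"
        using pos3_unsteps by simp
      then show ?thesis
        using pos unfolding pos3_def step_def by auto
    qed
    then show ?thesis
      unfolding v_def xyz using pos by simp
  qed
  have "seq_compact ({0..1} \<times> ({0..1} \<times> {1::real}) :: (real \<times> real \<times> real) set)"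
    by (intro compact_imp_seq_compact compact_Times) auto
  from seq_compactE[OF this, of v] v obtain l r
    where l: "l \<in> {0..1} \<times> ({0..1} \<times> {1})" and r: "strict_mono r" and lim: "(v \<circ> r) \<longlonglongrightarrow> l"
    by blast
  define d where "d = steps l"
  have lim_d: "(\<lambda>n. steps (v (r n)) k) \<longlonglongrightarrow> d k" for k
  proof (induction k)
    case 0
    then show ?case
      using lim by (simp add: d_def o_def)
  next
    case (Suc k)
    then show ?case
      unfolding d_def steps.simps step_def by (intro tendsto_intros)
  qed
  \<comment> \<open>Here \<open>r n \<ge> n \<ge> k\<close>, so level \<open>k\<close> is among
    those at which the approximant is positive by construction.\<close>
  have pos_v: "pos3 (steps (v (r n)) k)" if "k \<le> n" for n k
  proof -
    have "r n = (r n - k) + k"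
      using seq_suble[OF r, of n] that by simp
    then have "steps (unsteps (r n) 0) k = unsteps (r n - k) k"
      using steps_unsteps by metis
    then show ?thesis
      using pos3_unsteps[of "r n - k" k] pos3_unsteps[of "r n" 0]
      unfolding v_def steps_scaleR by (simp add: pos3_def)
  qed
  have nonneg: "nonneg3 (d k)" for k
    unfolding nonneg3_def
  proof (intro conjI)
    have ev: "\<exists>N. \<forall>n\<ge>N. 0 \<le> fst (steps (v (r n)) k)"
        "\<exists>N. \<forall>n\<ge>N. 0 \<le> fst (snd (steps (v (r n)) k))"
        "\<exists>N. \<forall>n\<ge>N. 0 \<le> snd (snd (steps (v (r n)) k))"
      using pos_v[of k] unfolding pos3_def by (meson less_imp_le)+
    show "0 \<le> fst (d k)"
      by (intro LIMSEQ_le_const[OF tendsto_fst[OF lim_d]] ev)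
    show "0 \<le> fst (snd (d k))"
      by (intro LIMSEQ_le_const[OF tendsto_fst[OF tendsto_snd[OF lim_d]]] ev)
    show "0 \<le> snd (snd (d k))"
      by (intro LIMSEQ_le_const[OF tendsto_snd[OF tendsto_snd[OF lim_d]]] ev)
  qed
  have nz: "d k \<noteq> 0" for k
  proof (induction k)
    case 0
    then show ?case
      using l by (auto simp: d_def zero_prod_def)
  next
    case (Suc k)
    have "unstep k (d (Suc k)) = d k"
      by (simp add: d_def unstep_step)
    moreover have "unstep k 0 = 0"
      by (simp add: unstep_def prod_eq_iff)
    ultimately show ?case
      using Suc by metis
  qed
  \<comment> \<open>Limits of positive triples are only nonnegative, but each \<open>d k\<close> is
    the image of the nonzero triple \<open>d (Suc k)\<close> under a positive matrix.\<close>
  have "pos3 (unstep k (d (Suc k)))" for k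
    by (rule pos3_unstep[OF nonneg nz])
  then have pos: "pos3 (d k)" for k
    by (simp add: d_def unstep_step)
  have "expansion (\<lambda>k. fst (d k)) (\<lambda>k. fst (snd (d k))) (\<lambda>k. snd (snd (d k)))"
  proof
    show "snd (snd (d 0)) = 1"
      using l by (auto simp: d_def)
  qed (use pos in \<open>auto simp: pos3_def d_def step_def\<close>)
  then show ?thesis
    by blast
qed

section \<open>Growth of factorials\<close>

lemma fact_ge_power2: "2 ^ k \<le> (2 * fact k :: real)"
proof (induction k)
  case (Suc k)
  show ?case
  proof (cases "k = 0")
    case False
    then have "2 * (2 * fact k) \<le> (real k + 1) * (2 * fact k)"
      by (intro mult_right_mono) auto
    moreover have "2 * fact (Suc k) = (real k + 1) * (2 * fact k)"
      by (simp add: algebra_simps)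
    ultimately show ?thesis
      using Suc unfolding power_Suc by linarith
  qed simp
qed simp

lemma ln_fact_ge: "(real k - 1) * ln 2 \<le> ln (fact k)"
proof -
  have "ln (2 ^ k :: real) \<le> ln (2 * fact k)"
    using fact_ge_power2[of k] by (intro ln_mono) auto
  also have "\<dots> = ln 2 + ln (fact k)"
    by (simp add: ln_mult)
  finally show ?thesis
    by (simp add: ln_realpow algebra_simps)
qed

lemma ln_fact_at_top: "filterlim (\<lambda>k. ln (fact k) :: real) at_top sequentially"
proof (rule filterlim_at_top_mono)
  show "filterlim (\<lambda>k. (real k - 1) * ln 2) at_top sequentially"
    by real_asymp
qed (auto simp: ln_fact_ge)

lemma ln_fact_pos: "\<forall>\<^sub>F k in sequentially. 0 < ln (fact k :: real)"
  using ln_fact_at_top unfolding filterlim_at_top_dense by blast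

lemma ln_fact_shift: "ln (fact (k + d)) \<le> ln (fact k) + real d * ln (real (k + d) + 1)"
proof (induction d)
  case (Suc d)
  have "ln (fact (k + Suc d)) = ln (real (k + Suc d)) + ln (fact (k + d))"
    unfolding add_Suc_right fact_Suc by (subst ln_mult) auto
  also have "\<dots> \<le> ln (real (k + Suc d) + 1) + (ln (fact k) + real d * ln (real (k + Suc d) + 1))"
  proof (intro add_mono order_trans[OF Suc] mult_left_mono)
    show "ln (real (k + Suc d)) \<le> ln (real (k + Suc d) + 1)"
      by (intro ln_mono) auto
    show "ln (real (k + d) + 1) \<le> ln (real (k + Suc d) + 1)"
      by (intro ln_mono) auto
  qed auto
  finally show ?case
    by (simp add: algebra_simps)
qed simp

text \<open>A shift by \<open>d\<close> adds at most \<open>d\<close> logarithms of size about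
  \<open>ln k\<close>, while \<open>ln (fact k)\<close> grows at least linearly. So the index shifts
  in the covering and length bounds do not affect the dimension.\<close>

lemma ln_fact_ratio_tendsto: "(\<lambda>k. ln (fact (k + d)) / ln (fact k) :: real) \<longlonglongrightarrow> 1"
proof (rule tendsto_sandwich)
  have pos: "\<forall>\<^sub>F k in sequentially. 0 < ln (fact k :: real)"
    by (rule ln_fact_pos)
  then show "\<forall>\<^sub>F k in sequentially. 1 \<le> ln (fact (k + d)) / ln (fact k :: real)"
  proof eventually_elim
    case (elim k)
    have "ln (fact k :: real) \<le> ln (fact (k + d))"
      by (intro ln_mono fact_mono) auto
    with elim show ?case
      by (simp add: le_divide_eq)
  qed
  show "\<forall>\<^sub>F k in sequentially. ln (fact (k + d)) / ln (fact k :: real)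
      \<le> 1 + real d * (ln (real (k + d) + 1) / ((real k - 1) * ln 2))"
    using pos eventually_gt_at_top[of 1]
  proof eventually_elim
    case (elim k)
    have "ln (fact (k + d)) / ln (fact k :: real) \<le> (ln (fact k) + real d * ln (real (k + d) + 1)) / ln (fact k)"
      using elim by (intro divide_right_mono ln_fact_shift) auto
    also have "\<dots> = 1 + real d * (ln (real (k + d) + 1) / ln (fact k))"
      using elim by (simp add: add_divide_distrib)
    also have "\<dots> \<le> 1 + real d * (ln (real (k + d) + 1) / ((real k - 1) * ln 2))"
      using elim ln_fact_ge[of k] by (intro add_mono mult_left_mono divide_left_mono) auto
    finally show ?case .
  qed
  have "(\<lambda>k. ln (real k + real d + 1) / ((real k - 1) * ln 2)) \<longlonglongrightarrow> 0"
    by real_asymp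
  then have "(\<lambda>k. 1 + real d * (ln (real (k + d) + 1) / ((real k - 1) * ln 2))) \<longlonglongrightarrow> 1 + real d * 0"
    by (intro tendsto_intros) simp
  then show "(\<lambda>k. 1 + real d * (ln (real (k + d) + 1) / ((real k - 1) * ln 2))) \<longlonglongrightarrow> 1"
    by simp
qed simp

lemma upper_ratio_tendsto: "(\<lambda>k. ln (fact (k + 4)) / (2 * ln (fact k) - ln 8) :: real) \<longlonglongrightarrow> 1 / 2"
proof -
  have "(\<lambda>k. ln 8 / ln (fact k) :: real) \<longlonglongrightarrow> 0"
    by (intro tendsto_divide_0[OF tendsto_const] filterlim_at_top_imp_at_infinity ln_fact_at_top)
  from tendsto_divide[OF ln_fact_ratio_tendsto[of 4] tendsto_diff[OF tendsto_const[of 2] this]]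
  have "(\<lambda>k. (ln (fact (k + 4)) / ln (fact k)) / (2 - ln 8 / ln (fact k)) :: real) \<longlonglongrightarrow> 1 / 2"
    by simp
  moreover have "\<forall>\<^sub>F k in sequentially. 0 < ln (fact k :: real)"
    by (rule ln_fact_pos)
  then have "\<forall>\<^sub>F k in sequentially. (ln (fact (k + 4)) / ln (fact k)) / (2 - ln 8 / ln (fact k))
      = (ln (fact (k + 4)) / (2 * ln (fact k) - ln 8) :: real)"
  proof eventually_elim
    case (elim k)
    then have "2 - ln 8 / ln (fact k) = (2 * ln (fact k) - ln 8) / ln (fact k :: real)"
      by (simp add: diff_divide_distrib)
    with elim show ?case
      by simp
  qed
  ultimately show ?thesis
    by (rule Lim_transform_eventually)
qed

lemma lower_ratio_tendsto:
  "(\<lambda>k. (ln (fact k) - ln 2) / (ln 16 + 2 * ln (fact (k + 2))) :: real) \<longlonglongrightarrow> 1 / 2"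
proof -
  have lim0: "(\<lambda>k. x / ln (fact k) :: real) \<longlonglongrightarrow> 0" for x
    by (intro tendsto_divide_0[OF tendsto_const] filterlim_at_top_imp_at_infinity ln_fact_at_top)
  have "(\<lambda>k. (1 - ln 2 / ln (fact k)) / (ln 16 / ln (fact k) + 2 * (ln (fact (k + 2)) / ln (fact k))) :: real)
      \<longlonglongrightarrow> (1 - 0) / (0 + 2 * 1)"
    by (intro tendsto_intros lim0 ln_fact_ratio_tendsto) simp
  moreover have "\<forall>\<^sub>F k in sequentially. 0 < ln (fact k :: real)"
    by (rule ln_fact_pos)
  then have "\<forall>\<^sub>F k in sequentially.
      (1 - ln 2 / ln (fact k)) / (ln 16 / ln (fact k) + 2 * (ln (fact (k + 2)) / ln (fact k)))
      = ((ln (fact k) - ln 2) / (ln 16 + 2 * ln (fact (k + 2))) :: real)"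
  proof eventually_elim
    case (elim k)
    then have "1 - ln 2 / ln (fact k) = (ln (fact k) - ln 2) / ln (fact k :: real)"
      "ln 16 / ln (fact k) + 2 * (ln (fact (k + 2)) / ln (fact k))
        = (ln 16 + 2 * ln (fact (k + 2))) / ln (fact k :: real)"
      by (simp_all add: diff_divide_distrib add_divide_distrib del: fact_Suc)
    with elim show ?case
      by (simp del: fact_Suc)
  qed
  ultimately show ?thesis
    by (simp add: Lim_transform_eventually)
qed

section \<open>The dimension of the orbit\<close>

lemma common_denominator:
  fixes x y z :: rat
  obtains d p q r :: int where "d \<noteq> 0" "of_int p = of_int d * x" "of_int q = of_int d * y"
    "of_int r = of_int d * z"
proof -
  have *: "\<exists>n d :: int. d \<noteq> 0 \<and> of_int n = of_int d * x" for x :: rat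
  proof (cases x)
    case (Fract n d)
    then show ?thesis
      by (intro exI[of _ n] exI[of _ d]) (simp add: Fract_of_int_quotient)
  qed
  obtain n1 d1 n2 d2 n3 d3 :: int where nd: "d1 \<noteq> 0" "of_int n1 = of_int d1 * x"
      "d2 \<noteq> 0" "of_int n2 = of_int d2 * y" "d3 \<noteq> 0" "of_int n3 = of_int d3 * z"
    using *[of x] *[of y] *[of z] by blast
  show ?thesis
    by (rule that[of "d1 * d2 * d3" "n1 * d2 * d3" "n2 * d1 * d3" "n3 * d1 * d2"]) (use nd in simp_all)
qed

context expansion
begin

section \<open>Linear independence\<close>

lemma form_nonzero:
  fixes p q r :: int
  assumes "p \<noteq> 0 \<or> q \<noteq> 0 \<or> r \<noteq> 0"
  shows "p * a 0 + q * b 0 + r \<noteq> 0"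
proof -
  define n where "n = nat (2 * (\<bar>p\<bar> + \<bar>q\<bar>) + 1)"
  \<comment> \<open>As \<open>n!\<close> is unbounded, every fixed form meets the size condition of
    \<open>form_ge\<close> at some level.\<close>
  have "int n \<le> int (fact n)"
    unfolding of_nat_le_iff by (rule fact_ge_self)
  then have "2 * (\<bar>p\<bar> + \<bar>q\<bar>) < fact n"
    unfolding n_def of_nat_fact by linarith
  from form_ge[OF this assms] c_pos[of n] show ?thesis
    by auto
qed

lemma distinct_1_a_b: "distinct [1, a 0, b 0]"
  using form_nonzero[of 1 0 "-1"] form_nonzero[of 0 1 "-1"] form_nonzero[of 1 "-1" 0] by auto

lemma independent_1_a_b: "rat_real.independent {1, a 0, b 0}"
proof (rule rat_real.independent_if_scalars_zero)
  fix f :: "real \<Rightarrow> rat" and v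
  assume sum: "(\<Sum>x\<in>{1, a 0, b 0}. of_rat (f x) * x) = 0" and v: "v \<in> {1, a 0, b 0}"
  obtain d p q r :: int where d: "d \<noteq> 0" and pqr: "of_int p = of_int d * f (a 0)"
      "of_int q = of_int d * f (b 0)" "of_int r = of_int d * f 1"
    using common_denominator by metis
  have pqr': "real_of_int p = of_int d * of_rat (f (a 0))"
    "real_of_int q = of_int d * of_rat (f (b 0))" "real_of_int r = of_int d * of_rat (f 1)"
    using pqr[THEN arg_cong[of _ _ "of_rat :: rat \<Rightarrow> real"]] by (simp_all add: of_rat_mult)
  have "of_rat (f 1) + (of_rat (f (a 0)) * a 0 + of_rat (f (b 0)) * b 0) = 0"
    using sum distinct_1_a_b by simp
  then have "p * a 0 + q * b 0 + r = 0"
    unfolding pqr' by (metis (no_types, opaque_lifting) add.commute distrib_left mult.assoc mult_zero_right)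
  then have "p = 0 \<and> q = 0 \<and> r = 0"
    using form_nonzero by blast
  then show "f v = 0"
    using pqr d v by auto
qed simp

section \<open>The two bounds for the dimension\<close>

lemma upper_box_dim_orbit_le: "upper_box_dim orbit \<le> ereal (1 / 2)"
  unfolding upper_box_dim_def Limsup_le_iff
proof (intro allI impI)
  fix y :: ereal assume "ereal (1 / 2) < y"
  then obtain s where s: "ereal (1 / 2) < ereal s" "ereal s < y"
    using ereal_dense2 by blast
  have "\<forall>\<^sub>F k in sequentially. ln (fact (k + 4)) / (2 * ln (fact k) - ln 8) < s"
    using order_tendstoD(2)[OF upper_ratio_tendsto] s(1) by simp
  then obtain K0 where K0: "\<And>k. k \<ge> K0 \<Longrightarrow> ln (fact (k + 4)) / (2 * ln (fact k) - ln 8) < s"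
    unfolding eventually_sequentially by blast
  \<comment> \<open>From level 3 on \<open>k! \<ge> 6\<close>, so the denominator
    \<open>2 * ln (fact k) - ln 8\<close> is positive.\<close>
  define K where "K = max K0 3"
  have "\<forall>\<^sub>F \<rho> in at_right 0. \<rho> < 8 * c K"
    using c_pos[of K] by (intro eventually_at_right_real[THEN eventually_mono]) auto
  moreover have "\<forall>\<^sub>F \<rho> in at_right (0::real). 0 < \<rho>"
    by (rule eventually_at_right_less)
  ultimately show "\<forall>\<^sub>F \<rho> in at_right 0. ereal (ln (real (covering_number orbit \<rho>)) / ln (1 / \<rho>)) < y"
  proof eventually_elim
    case (elim \<rho>)
    have "\<exists>k. 8 * c k \<le> \<rho>"
    proof -
      have "(\<lambda>k. 8 * c k) \<longlonglongrightarrow> 0"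
        using tendsto_mult_left[OF c_tendsto, of 8] by simp
      from order_tendstoD(2)[OF this elim(2)] show ?thesis
        unfolding eventually_sequentially by (meson less_imp_le order_refl)
    qed
    \<comment> \<open>Level \<open>j\<close> covers at scale \<open>\<rho>\<close>, while its
      predecessor \<open>k\<close> satisfies \<open>\<rho> < 8 * c k\<close>, which bounds
      \<open>1 / \<rho>\<close> from below. The index gap turns \<open>k + 3\<close> into
      \<open>k + 4\<close>.\<close>
    define j where "j = (LEAST k. 8 * c k \<le> \<rho>)"
    have j: "8 * c j \<le> \<rho>"
      unfolding j_def using \<open>\<exists>k. 8 * c k \<le> \<rho>\<close> by (rule LeastI_ex)
    have "\<not> j \<le> K"
    proof
      assume "j \<le> K"
      then have "c K \<le> c j"
        using c_decseq by (rule decseqD[rotated])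
      with j elim(1) show False
        by linarith
    qed
    then obtain k where k: "j = Suc k" "K \<le> k"
      by (cases j) auto
    have "\<not> 8 * c k \<le> \<rho>"
      using not_less_Least[of k "\<lambda>k. 8 * c k \<le> \<rho>"] k(1) unfolding j_def by simp
    then have \<rho>: "\<rho> < 8 * c k"
      by simp
    have "covering_number orbit \<rho> \<le> fact (Suc k + 3)"
      using covering_number_orbit_le j k(1) by blast
    moreover have "Suc k + 3 = k + 4"
      by simp
    ultimately have "real (covering_number orbit \<rho>) \<le> real (fact (k + 4))"
      unfolding of_nat_le_iff by (simp only:)
    then have N: "real (covering_number orbit \<rho>) \<le> fact (k + 4)"
      by (simp only: of_nat_fact)
    have num: "ln (real (covering_number orbit \<rho>)) \<le> ln (fact (k + 4))"
    proof (cases "covering_number orbit \<rho> = 0")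
      case True
      then show ?thesis
        using ln_mono[of 1 "fact (k + 4) :: real"] by simp
    next
      case False
      then show ?thesis
        using N by (intro ln_mono) auto
    qed
    have "fact 3 \<le> (fact k :: real)"
      using k(2) unfolding K_def by (intro fact_mono) auto
    then have f6: "6 \<le> (fact k :: real)"
      by (simp add: fact_numeral)
    have "8 < (6 :: real)^2"
      by simp
    also have "\<dots> \<le> (fact k)^2"
      using f6 by (intro power_mono) auto
    finally have "ln 8 < ln ((fact k :: real)^2)"
      by simp
    then have den0: "0 < 2 * ln (fact k) - ln (8::real)"
      by (simp add: ln_realpow)
    have "\<rho> \<le> 8 / (fact k)^2"
      using \<rho> c_upper[of k] by simp
    then have "(fact k)^2 / 8 \<le> 1 / \<rho>"
      using elim(2) by (simp add: field_simps)
    then have "ln ((fact k)^2 / 8) \<le> ln (1 / \<rho>)"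
      by (intro ln_mono) auto
    then have den: "2 * ln (fact k) - ln 8 \<le> ln (1 / \<rho>)"
      by (simp add: ln_div ln_realpow)
    have "ln (real (covering_number orbit \<rho>)) / ln (1 / \<rho>) \<le> ln (fact (k + 4)) / (2 * ln (fact k) - ln 8)"
      using num den den0 by (intro frac_le) auto
    also have "\<dots> < s"
      using K0 k(2) unfolding K_def by simp
    finally show ?case
      using s(2) by (metis ereal_less_le less_eq_ereal_def less_ereal.simps(1) order_less_trans)
  qed
qed

text \<open>Forms with coefficient sum below \<open>k! / 2\<close> are at least
  \<open>c k / 8\<close>; halving this length makes the separation strict.\<close>

lemma covering_number_orbit_ge: "fact k div 2 \<le> covering_number orbit (c k / 16)"
proof (rule le_covering_number_alpha_beta[OF alpha_beta_set_orbit orbit_nonempty])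
  show "0 < c k / 16"
    using c_pos by simp
  fix p q r :: int
  assume pq: "p \<ge> 0" "q \<ge> 0" "0 < p + q" "p + q < int (fact k div 2)"
  have "2 * x < int n" if "x < int (n div 2)" for x n
    using that by linarith
  from this[OF pq(4)] pq(1,2) have "2 * (\<bar>p\<bar> + \<bar>q\<bar>) < int (fact k)"
    by (simp only: abs_of_nonneg)
  then have "2 * (\<bar>p\<bar> + \<bar>q\<bar>) < fact k"
    by (simp only: of_nat_fact)
  moreover have "p \<noteq> 0 \<or> q \<noteq> 0 \<or> r \<noteq> 0"
    using pq by auto
  ultimately have "c k / 8 \<le> \<bar>p * a 0 + q * b 0 + r\<bar>"
    by (rule form_ge)
  then show "c k / 16 < \<bar>p * a 0 + q * b 0 + r\<bar>"
    using c_pos[of k] by linarith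
qed

lemma upper_box_dim_orbit_ge: "ereal (1 / 2) \<le> upper_box_dim orbit"
proof (rule ccontr)
  assume "\<not> ?thesis"
  then have "upper_box_dim orbit < ereal (1 / 2)"
    by simp
  then obtain s where s: "upper_box_dim orbit < ereal s" "ereal s < ereal (1 / 2)"
    using ereal_dense2 by blast
  have "\<forall>\<^sub>F \<rho> in at_right 0. ereal (ln (real (covering_number orbit \<rho>)) / ln (1 / \<rho>)) < ereal s"
    using s(1) unfolding upper_box_dim_def by (rule Limsup_lessD)
  \<comment> \<open>For an upper limit it suffices to test the scales \<open>c k / 16\<close>, which
    tend to 0 from the right.\<close>
  moreover have "filterlim (\<lambda>k. c k / 16) (at_right 0) sequentially"
  proof (rule tendsto_imp_filterlim_at_right)
    show "(\<lambda>k. c k / 16) \<longlonglongrightarrow> 0"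
      using tendsto_divide[OF c_tendsto tendsto_const[of 16]] by simp
  qed (use c_pos in auto)
  ultimately have "\<forall>\<^sub>F k in sequentially.
      ereal (ln (real (covering_number orbit (c k / 16))) / ln (1 / (c k / 16))) < ereal s"
    by (rule eventually_compose_filterlim)
  moreover have "\<forall>\<^sub>F k in sequentially. s < (ln (fact k) - ln 2) / (ln 16 + 2 * ln (fact (k + 2)))"
    using order_tendstoD(1)[OF lower_ratio_tendsto] s(2) by simp
  moreover have "\<forall>\<^sub>F k :: nat in sequentially. 2 \<le> k"
    by (rule eventually_ge_at_top)
  ultimately have "\<forall>\<^sub>F k :: nat in sequentially. False"
  proof eventually_elim
    case (elim k)
    \<comment> \<open>For \<open>k \<ge> 2\<close> the factorial is even, so the integer division by
      2 is exact.\<close>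
    have "(2::nat) dvd fact k"
      using elim(3) by (intro dvd_fact) auto
    then have "real (fact k div 2) = fact k / 2"
      by (simp add: real_of_nat_div)
    then have N: "fact k / 2 \<le> real (covering_number orbit (c k / 16))"
      using covering_number_orbit_ge[of k] by (metis of_nat_le_iff)
    have "ln (fact k / 2) \<le> ln (real (covering_number orbit (c k / 16)))"
      using N by (intro ln_mono) auto
    then have num: "ln (fact k) - ln 2 \<le> ln (real (covering_number orbit (c k / 16)))"
      by (simp add: ln_div)
    have "fact 2 \<le> (fact k :: real)"
      using elim(3) by (intro fact_mono)
    then have num0: "0 \<le> ln (fact k) - ln (2::real)"
      by (simp add: ln_mono)
    have "16 / c k \<le> 16 * (fact (k + 2))^2"
      using c_lower[of k] c_pos[of k] by (simp add: field_simps del: fact_Suc)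
    then have "ln (16 / c k) \<le> ln (16 * (fact (k + 2))^2)"
      using c_pos[of k] by (intro ln_mono) auto
    also have "\<dots> = ln 16 + 2 * ln (fact (k + 2))"
      by (subst ln_mult) (auto simp: ln_realpow simp del: fact_Suc)
    finally have den: "ln (1 / (c k / 16)) \<le> ln 16 + 2 * ln (fact (k + 2))"
      by simp
    have "c k \<le> c 0"
      using c_decseq by (rule decseqD) simp
    then have "1 < 16 / c k"
      using c_pos[of k] c_0 by (simp add: field_simps)
    from ln_gt_zero[OF this] have den0: "0 < ln (1 / (c k / 16))"
      by simp
    have "(ln (fact k) - ln 2) / (ln 16 + 2 * ln (fact (k + 2)))
        \<le> ln (real (covering_number orbit (c k / 16))) / ln (1 / (c k / 16))"
      by (rule frac_le[OF order_trans[OF num0 num] num den0 den])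
    then show False
      using elim(1,2) by simp
  qed
  then show False
    by simp
qed

end

theorem theorem1p1:
  shows "\<exists>(\<alpha>::real) (\<beta>::real).
           distinct [1, \<alpha>, \<beta>] \<and> rat_real.independent {1, \<alpha>, \<beta>} \<and>
           (\<exists>E :: circle set. alpha_beta_set \<alpha> \<beta> E \<and> upper_box_dim E = ereal (1 / 2))"
proof -
  obtain a b c where "expansion a b c"
    using expansion_exists by blast
  then interpret expansion a b c .
  have "upper_box_dim orbit = ereal (1 / 2)"
    using upper_box_dim_orbit_le upper_box_dim_orbit_ge by (rule antisym)
  then show ?thesis
    using distinct_1_a_b independent_1_a_b alpha_beta_set_orbit by blast
qed

end
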